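(* Let $M$ be a matroid with ground set $E$ and lattice of flats $\mathcal{L}$. The local motivic zeta function of $M$ satisfies the recurrence relation \[ q^{\operatorname{rk} M}Z_{M}^0(q,T) = \frac{(q-1)q^{-\operatorname{rk} M} T^{\# E}}{1 - q^{-\operatorname{rk} M}T^{\# E}} \left( \overline{\chi}_M(q) + \sum_{F \in \widehat\mathcal{L}} \overline{\chi}_{M/F}(q) q^{\operatorname{rk}(M | F)} Z_{M|F}^0 (q, T) \right), \] where $\widehat\mathcal{L} = \mathcal{L} \setminus \{\operatorname{cl}(\emptyset), E\}$.
   Context: For a matroid $N$ on ground set $E_N$ with rank function $\operatorname{rk}$, characteristic polynomial $\chi_N$ and reduced characteristic polynomial $\overline{\chi}_N=\chi_N/(q-1)$: for $w\in\mathbb{R}^{E_N}$ let $\operatorname{wt}_N(w)=\max_{B\text{ basis}}\sum_{e\in B}w_e$, let $N_w$ be the matroid on $E_N$ whose bases are the bases of $N$ attaining this maximum, and $|w|=\sum_e w_e$. The local motivic zeta function is $Z_N^0(q,T)=\sum_{w\in\mathbb{Z}_{>0}^{E_N}}\chi_{N_w}(q)q^{-\operatorname{rk}N-\operatorname{wt}_N(w)}T^{|w|}$. Here $M|F$ and $M/F$ denote restriction and contraction. *)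

theory Defs
  imports "HOL-Computational_Algebra.Computational_Algebra"
begin

record 'a indep_structure =
  ground :: "'a set"
  indep :: "'a set set"

locale matroid =
  fixes M :: "'a indep_structure"
  assumes finite_ground: "finite (ground M)"
    and indep_subset_ground: "I \<in> indep M \<Longrightarrow> I \<subseteq> ground M"
    and indep_empty: "{} \<in> indep M"
    and indep_mono: "I \<in> indep M \<Longrightarrow> J \<subseteq> I \<Longrightarrow> J \<in> indep M"
    and augmentation:
      "I \<in> indep M \<Longrightarrow> J \<in> indep M \<Longrightarrow> card I < card J \<Longrightarrow> \<exists>x\<in>J - I. insert x I \<in> indep M"

definition bases :: "'a indep_structure \<Rightarrow> 'a set set" where
  "bases M = {B \<in> indep M. \<forall>I\<in>indep M. B \<subseteq> I \<longrightarrow> I = B}"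

definition rank_of :: "'a indep_structure \<Rightarrow> 'a set \<Rightarrow> nat" where
  "rank_of M A = Max (card ` {I \<in> indep M. I \<subseteq> A})"

definition rk :: "'a indep_structure \<Rightarrow> nat" where
  "rk M = rank_of M (ground M)"

definition cl :: "'a indep_structure \<Rightarrow> 'a set \<Rightarrow> 'a set" where
  "cl M A = {e \<in> ground M. rank_of M (insert e A) = rank_of M A}"

definition flats :: "'a indep_structure \<Rightarrow> 'a set set" where
  "flats M = {F. F \<subseteq> ground M \<and> cl M F = F}"

definition restriction :: "'a indep_structure \<Rightarrow> 'a set \<Rightarrow> 'a indep_structure" where
  "restriction M F = \<lparr>ground = ground M \<inter> F, indep = {I \<in> indep M. I \<subseteq> F}\<rparr>"

(* For a matroid the choice of the basis B of M|F is immaterial. *)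
definition contraction :: "'a indep_structure \<Rightarrow> 'a set \<Rightarrow> 'a indep_structure" where
  "contraction M F =
     \<lparr>ground = ground M - F,
      indep = {I. I \<subseteq> ground M - F \<and> (\<exists>B\<in>bases (restriction M F). I \<union> B \<in> indep M)}\<rparr>"

definition wt :: "'a indep_structure \<Rightarrow> ('a \<Rightarrow> 'b::linordered_idom) \<Rightarrow> 'b" where
  "wt M w = Max ((\<lambda>B. \<Sum>e\<in>B. w e) ` bases M)"

(* The matroid M_w, given by its bases: the bases of M of maximal w-weight. *)
definition initial_matroid ::
  "'a indep_structure \<Rightarrow> ('a \<Rightarrow> 'b::linordered_idom) \<Rightarrow> 'a indep_structure" where
  "initial_matroid M w =
     \<lparr>ground = ground M,
      indep = {I. \<exists>B\<in>bases M. (\<Sum>e\<in>B. w e) = wt M w \<and> I \<subseteq> B}\<rparr>"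

(* Boolean (corank) expansion of the characteristic polynomial; it vanishes if M has a loop.
   The natural-number subtraction is harmless since the rank function is monotone. *)
definition char_poly :: "'a indep_structure \<Rightarrow> int poly" where
  "char_poly M = (\<Sum>A\<in>Pow (ground M). monom ((-1) ^ card A) (rk M - rank_of M A))"

(* The indeterminate q, in the field of rational functions Q(q) = Frac Z[q]; power series in T
   have coefficients in this field, which contains Z[q, 1/q]. *)
definition q_var :: "int poly fract" where
  "q_var = to_fract [:0, 1:]"

definition chi :: "'a indep_structure \<Rightarrow> int poly fract" where
  "chi M = to_fract (char_poly M)"

definition reduced_chi :: "'a indep_structure \<Rightarrow> int poly fract" where
  "reduced_chi M = chi M / (q_var - 1)"

(* The sum over all positive integer weights, as a power series in T: the coefficient of T^n
   collects the finitely many w with |w| = n. Weights are extensional functions, so that each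
   element of Z_{>0}^E is counted exactly once. *)
definition local_motivic_zeta :: "'a indep_structure \<Rightarrow> int poly fract fps" where
  "local_motivic_zeta M = Abs_fps (\<lambda>n.
     \<Sum>w | w \<in> ground M \<rightarrow>\<^sub>E {0::int<..} \<and> (\<Sum>e\<in>ground M. w e) = int n.
       chi (initial_matroid M w) * q_var powi (- int (rk M) - wt M w))"

end

theory Submission
  imports Defs
begin

text \<open>
  Write a positive weight as w = 1 + u with u \<ge> 0 and let F be the support of u. A basis of M has
  maximal w-weight iff it meets F in a basis of M|F of maximal u-weight, so M_w is the direct sum
  of (M|F)_u and M/F, and wt_M(w) = rk M + wt_(M|F)(u). As the characteristic polynomial is
  multiplicative on direct sums, summing over all pairs (F, u) gives
  q^(rk M) Z_M = q^(-rk M) T^(#E) (\<Sum>F. chi_(M/F) q^(rk (M|F)) Z_(M|F)), where F ranges over all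
  subsets of E. If F is not a flat, then M/F has a loop and chi_(M/F) vanishes; the summand F = E
  is q^(rk M) Z_M itself and is moved to the left-hand side. If M has no loops, the summand for
  F = {} = cl {} is chi_M; if M has a loop, then every term of the claim is 0.
\<close>

section \<open>Rank, bases and maximal weight of finite set systems\<close>

text \<open>A common setting for matroids, their contractions and their initial matroids: rank,
  basis and characteristic polynomial facts then apply to the latter two without a proof of the
  augmentation axiom for them.\<close>

locale set_system =
  fixes N :: "'a indep_structure"
  assumes finite_ground: "finite (ground N)"
    and indep_subset_ground: "I \<in> indep N \<Longrightarrow> I \<subseteq> ground N"
    and indep_empty: "{} \<in> indep N"
begin

lemma finite_indep: "finite (indep N)"
  using finite_ground indep_subset_ground by (meson Pow_iff finite_Pow_iff finite_subset subsetI)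

lemma finite_indep_set: "I \<in> indep N \<Longrightarrow> finite I"
  using finite_ground indep_subset_ground finite_subset by blast

lemma card_le_rank_of: "card I \<le> rank_of N A" if "I \<in> indep N" "I \<subseteq> A"
  unfolding rank_of_def using that finite_indep by (intro Max_ge) auto

lemma rank_of_attained:
  obtains I where "I \<in> indep N" "I \<subseteq> A" "card I = rank_of N A"
proof -
  have "rank_of N A \<in> card ` {I \<in> indep N. I \<subseteq> A}"
    unfolding rank_of_def using finite_indep indep_empty by (intro Max_in) auto
  then show ?thesis using that by auto
qed

lemma rank_of_le_rk: "rank_of N A \<le> rk N"
proof -
  obtain I where "I \<in> indep N" "card I = rank_of N A" by (rule rank_of_attained)
  then show ?thesis unfolding rk_def using card_le_rank_of indep_subset_ground by metis
qed

lemma finite_bases: "finite (bases N)"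
  unfolding bases_def using finite_indep by auto

lemma indep_subset_basis:
  assumes "I \<in> indep N"
  obtains B where "B \<in> bases N" "I \<subseteq> B"
proof -
  obtain B where "B \<in> indep N" "I \<subseteq> B" "\<forall>J\<in>indep N. B \<subseteq> J \<longrightarrow> B = J"
    using finite_has_maximal2[OF finite_indep assms] by blast
  then have "B \<in> bases N" unfolding bases_def by auto
  then show ?thesis using that \<open>I \<subseteq> B\<close> by blast
qed

lemma bases_nonempty: "bases N \<noteq> {}"
  using indep_subset_basis[OF indep_empty] by blast

lemma wt_attained:
  fixes w :: "'a \<Rightarrow> 'b::linordered_idom"
  obtains B where "B \<in> bases N" "(\<Sum>e\<in>B. w e) = wt N w"
proof -
  have "wt N w \<in> (\<lambda>B. \<Sum>e\<in>B. w e) ` bases N"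
    unfolding wt_def using finite_bases bases_nonempty by (intro Max_in) auto
  then show ?thesis using that by auto
qed

lemma sum_le_wt:
  fixes w :: "'a \<Rightarrow> 'b::linordered_idom"
  shows "B \<in> bases N \<Longrightarrow> (\<Sum>e\<in>B. w e) \<le> wt N w"
  unfolding wt_def using finite_bases by (intro Max_ge) auto

lemma set_system_initial_matroid:
  fixes w :: "'a \<Rightarrow> 'b::linordered_idom"
  shows "set_system (initial_matroid N w)"
proof
  show "finite (ground (initial_matroid N w))"
    by (simp add: initial_matroid_def finite_ground)
  show "I \<subseteq> ground (initial_matroid N w)" if "I \<in> indep (initial_matroid N w)" for I
    using that indep_subset_ground by (fastforce simp: initial_matroid_def bases_def)
  show "{} \<in> indep (initial_matroid N w)"
    using wt_attained[of w] by (auto simp: initial_matroid_def)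
qed

lemma set_system_restriction: "set_system (restriction N F)"
  using finite_ground indep_subset_ground indep_empty
  by unfold_locales (auto simp: restriction_def)

section \<open>Characteristic polynomials: loops and direct sums\<close>

text \<open>Adding a loop \<open>e\<close> to \<open>A\<close> keeps the rank and flips the sign, so
  the terms of \<open>A\<close> and \<open>insert e A\<close> in the Boolean expansion
  cancel.\<close>

lemma char_poly_loop:
  assumes e: "e \<in> ground N" and loop: "\<And>I. I \<in> indep N \<Longrightarrow> e \<notin> I"
  shows "char_poly N = 0"
proof -
  let ?D = "ground N - {e}"
  let ?f = "\<lambda>A. monom ((-1) ^ card A) (rk N - rank_of N A) :: int poly"
  have fin: "finite ?D" using finite_ground by simp
  have rank: "rank_of N (insert e A) = rank_of N A" for A
  proof -
    have "{I \<in> indep N. I \<subseteq> insert e A} = {I \<in> indep N. I \<subseteq> A}" using loop by blast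
    then show ?thesis by (simp add: rank_of_def)
  qed
  have "ground N = insert e ?D" using e by auto
  then have "char_poly N = sum ?f (Pow ?D \<union> insert e ` Pow ?D)"
    unfolding char_poly_def by (metis Pow_insert)
  also have "\<dots> = sum ?f (Pow ?D) + sum ?f (insert e ` Pow ?D)"
    using fin by (intro sum.union_disjoint) auto
  also have "sum ?f (insert e ` Pow ?D) = (\<Sum>A\<in>Pow ?D. ?f (insert e A))"
    by (rule sum.reindex_cong[of "insert e"]) (auto simp: inj_on_def)
  also have "\<dots> = (\<Sum>A\<in>Pow ?D. - ?f A)"
  proof (rule sum.cong[OF refl])
    fix A assume "A \<in> Pow ?D"
    then have "e \<notin> A" "finite A" using fin by (auto dest: finite_subset)
    then show "?f (insert e A) = - ?f A" by (simp add: rank minus_monom)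
  qed
  finally show ?thesis by (simp add: sum_negf)
qed

end

text \<open>Subsets of the ground set are pairs of subsets of the two parts, and both cardinality
  and rank are additive over such pairs; hence every term of the Boolean expansion factors.\<close>

lemma char_poly_direct_sum:
  assumes sys: "set_system N1" "set_system N2" "set_system N"
    and ground: "ground N = ground N1 \<union> ground N2" "ground N1 \<inter> ground N2 = {}"
    and indep: "indep N = {I \<union> J | I J. I \<in> indep N1 \<and> J \<in> indep N2}"
  shows "char_poly N = char_poly N1 * char_poly N2"
proof -
  interpret N1: set_system N1 by fact
  interpret N2: set_system N2 by fact
  interpret N: set_system N by fact
  let ?G1 = "ground N1" and ?G2 = "ground N2"
  have card_Un: "card (A \<union> B) = card A + card B" if "A \<subseteq> ?G1" "B \<subseteq> ?G2" for A B
    using that ground(2) N1.finite_ground N2.finite_ground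
    by (intro card_Un_disjoint) (auto dest: finite_subset)
  have rank: "rank_of N (A \<union> B) = rank_of N1 A + rank_of N2 B"
    if AB: "A \<subseteq> ?G1" "B \<subseteq> ?G2" for A B
  proof (rule antisym)
    obtain K where K: "K \<in> indep N" "K \<subseteq> A \<union> B" "card K = rank_of N (A \<union> B)"
      by (rule N.rank_of_attained)
    then obtain I J where IJ: "K = I \<union> J" "I \<in> indep N1" "J \<in> indep N2"
      using indep by auto
    then have sub: "I \<subseteq> ?G1" "J \<subseteq> ?G2"
      using N1.indep_subset_ground N2.indep_subset_ground by auto
    then have "I \<subseteq> A" "J \<subseteq> B" using K(2) IJ(1) AB ground(2) by blast+
    then show "rank_of N (A \<union> B) \<le> rank_of N1 A + rank_of N2 B"
      using K(3) IJ N1.card_le_rank_of N2.card_le_rank_of card_Un[OF sub] by (metis add_mono)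
  next
    obtain I where I: "I \<in> indep N1" "I \<subseteq> A" "card I = rank_of N1 A"
      by (rule N1.rank_of_attained)
    obtain J where J: "J \<in> indep N2" "J \<subseteq> B" "card J = rank_of N2 B"
      by (rule N2.rank_of_attained)
    have "card (I \<union> J) = card I + card J" using I J AB by (intro card_Un) auto
    moreover have "card (I \<union> J) \<le> rank_of N (A \<union> B)"
      using I J indep by (intro N.card_le_rank_of) auto
    ultimately show "rank_of N1 A + rank_of N2 B \<le> rank_of N (A \<union> B)" using I J by simp
  qed
  have rk: "rk N = rk N1 + rk N2" using rank[of ?G1 ?G2] by (simp add: rk_def ground)
  let ?f = "\<lambda>N A. monom ((-1) ^ card A) (rk N - rank_of N A) :: int poly"
  have f: "?f N (A \<union> B) = ?f N1 A * ?f N2 B" if AB: "A \<subseteq> ?G1" "B \<subseteq> ?G2" for A B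
  proof -
    \<comment> \<open>Truncated subtraction may be split here because neither rank exceeds the rank
      of its summand.\<close>
    have "rk N - rank_of N (A \<union> B) = (rk N1 - rank_of N1 A) + (rk N2 - rank_of N2 B)"
      using N1.rank_of_le_rk[of A] N2.rank_of_le_rk[of B] by (simp add: rk rank[OF AB])
    then show ?thesis by (simp add: mult_monom card_Un[OF AB] power_add)
  qed
  have "char_poly N = (\<Sum>(A, B)\<in>Pow ?G1 \<times> Pow ?G2. ?f N (A \<union> B))"
    unfolding char_poly_def
    by (rule sum.reindex_bij_witness[of _ "\<lambda>(A, B). A \<union> B" "\<lambda>A. (A \<inter> ?G1, A \<inter> ?G2)"])
      (use ground in \<open>auto simp: Int_absorb2 simp flip: Int_Un_distrib\<close>)
  also have "\<dots> = (\<Sum>(A, B)\<in>Pow ?G1 \<times> Pow ?G2. ?f N1 A * ?f N2 B)"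
    by (intro sum.cong refl) (auto simp: f)
  also have "\<dots> = char_poly N1 * char_poly N2"
    by (simp add: char_poly_def sum_product sum.cartesian_product)
  finally show ?thesis .
qed

sublocale matroid \<subseteq> set_system M
  using finite_ground indep_subset_ground indep_empty by unfold_locales

section \<open>Bases, restriction and contraction of a matroid\<close>

context matroid
begin

lemma set_system_contraction: "set_system (contraction M F)"
proof
  obtain B where B: "B \<in> bases (restriction M F)"
    using set_system.bases_nonempty[OF set_system_restriction] by blast
  then have "B \<in> indep M" by (simp add: bases_def restriction_def)
  then show "{} \<in> indep (contraction M F)" using B by (auto simp: contraction_def)
qed (auto simp: contraction_def finite_ground)

lemma matroid_restriction: "matroid (restriction M F)"
proof
  fix I J assume IJ: "I \<in> indep (restriction M F)" "J \<in> indep (restriction M F)" "card I < card J"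
  then have IJ': "I \<in> indep M" "J \<in> indep M" "I \<subseteq> F" "J \<subseteq> F" by (auto simp: restriction_def)
  from augmentation[OF IJ'(1,2) IJ(3)] obtain x where "x \<in> J - I" "insert x I \<in> indep M"
    by blast
  then show "\<exists>x\<in>J - I. insert x I \<in> indep (restriction M F)"
    using IJ' by (auto simp: restriction_def)
qed (use finite_ground indep_subset_ground indep_empty indep_mono in \<open>auto simp: restriction_def\<close>)

lemma rk_restriction: "rk (restriction M F) = rank_of M F"
proof -
  have "{I \<in> indep M. I \<subseteq> F \<and> I \<subseteq> ground M \<and> I \<subseteq> F} = {I \<in> indep M. I \<subseteq> F}"
    using indep_subset_ground by blast
  then show ?thesis by (simp add: rk_def rank_of_def restriction_def conj_ac)
qed

lemma restriction_ground: "restriction M (ground M) = M"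
proof -
  have "{I \<in> indep M. I \<subseteq> ground M} = indep M" using indep_subset_ground by blast
  then show ?thesis by (simp add: restriction_def)
qed

text \<open>A basis smaller than some independent set could be augmented, against its
  maximality.\<close>

lemma basis_card: "card B = rk M" if "B \<in> bases M"
proof (rule antisym)
  have B: "B \<in> indep M" "\<And>I. I \<in> indep M \<Longrightarrow> B \<subseteq> I \<Longrightarrow> I = B"
    using that by (auto simp: bases_def)
  show "card B \<le> rk M" unfolding rk_def using B(1) indep_subset_ground by (intro card_le_rank_of)
  obtain I where I: "I \<in> indep M" "card I = rk M"
    unfolding rk_def by (rule rank_of_attained)
  show "rk M \<le> card B"
  proof (rule ccontr)
    assume "\<not> ?thesis"
    then have "card B < card I" using I by simp
    from augmentation[OF B(1) I(1) this] obtain x where "x \<in> I - B" "insert x B \<in> indep M"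
      by blast
    then show False using B(2)[of "insert x B"] by blast
  qed
qed

text \<open>Augmentation is repeated until the size of \<open>J\<close> is reached, by induction on
  the gap. Every new element comes from \<open>J\<close>, which gives the bound
  \<open>I \<union> J\<close>.\<close>

lemma extend_indep:
  assumes "I \<in> indep M" "J \<in> indep M" "card I \<le> card J"
  obtains K where "K \<in> indep M" "I \<subseteq> K" "K \<subseteq> I \<union> J" "card K = card J"
proof -
  have "\<exists>K\<in>indep M. I \<subseteq> K \<and> K \<subseteq> I \<union> J \<and> card K = card J"
    using assms(1,3)
  proof (induction "card J - card I" arbitrary: I)
    case 0
    then show ?case by auto
  next
    case (Suc n)
    then have "card I < card J" by simp
    from augmentation[OF Suc.prems(1) assms(2) this]
    obtain x where x: "x \<in> J - I" "insert x I \<in> indep M" by blast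
    have c: "card (insert x I) = Suc (card I)"
      using x Suc.prems(1) finite_indep_set by simp
    have "n = card J - card (insert x I)" "card (insert x I) \<le> card J"
      using Suc.hyps(2) \<open>card I < card J\<close> by (simp_all only: c)
    from Suc.hyps(1)[OF this(1) x(2) this(2)]
    obtain K where "K \<in> indep M" "insert x I \<subseteq> K" "K \<subseteq> insert x I \<union> J" "card K = card J"
      by blast
    then show ?case using x by blast
  qed
  then show ?thesis using that by blast
qed

lemma basis_restriction_iff:
  "B \<in> bases (restriction M F) \<longleftrightarrow>
    B \<in> indep M \<and> B \<subseteq> F \<and> (\<forall>I\<in>indep M. I \<subseteq> F \<longrightarrow> B \<subseteq> I \<longrightarrow> I = B)"
  by (auto simp: bases_def restriction_def)

text \<open>The choice of \<open>B\<close> is immaterial: if \<open>B'\<close> witnesses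
  independence of \<open>J\<close>, extend \<open>B\<close> by elements of
  \<open>J \<union> B'\<close> to the size of \<open>J \<union> B'\<close>. Maximality of
  \<open>B\<close> in \<open>F\<close> forces all new elements into \<open>J\<close>, and counting
  shows that all of \<open>J\<close> is reached.\<close>

lemma indep_contraction_iff:
  assumes B: "B \<in> bases (restriction M F)"
  shows "J \<in> indep (contraction M F) \<longleftrightarrow> J \<subseteq> ground M - F \<and> J \<union> B \<in> indep M"
proof
  assume "J \<in> indep (contraction M F)"
  then obtain B' where J: "J \<subseteq> ground M - F" and B': "B' \<in> bases (restriction M F)"
    and JB': "J \<union> B' \<in> indep M" by (auto simp: contraction_def)
  have BF: "B \<in> indep M" "B \<subseteq> F" "\<And>I. I \<in> indep M \<Longrightarrow> I \<subseteq> F \<Longrightarrow> B \<subseteq> I \<Longrightarrow> I = B"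
    using B by (auto simp: basis_restriction_iff)
  have B'F: "B' \<subseteq> F" using B' by (auto simp: basis_restriction_iff)
  have fin: "finite J" "finite B" "finite B'"
    using JB' BF(1) finite_indep_set by auto
  have cBB': "card B = card B'"
    using matroid.basis_card[OF matroid_restriction] B B' by metis
  have cJ: "card (J \<union> B') = card J + card B'" "card (J \<union> B) = card J + card B"
    using J B'F BF(2) fin by (auto intro!: card_Un_disjoint)
  obtain K where K: "K \<in> indep M" "B \<subseteq> K" "K \<subseteq> B \<union> (J \<union> B')" "card K = card (J \<union> B')"
    using extend_indep[OF BF(1) JB'] cJ cBB' by auto
  \<comment> \<open>\<open>K \<inter> F\<close> is independent, lies in \<open>F\<close> and
    contains the maximal set \<open>B\<close>.\<close>
  have "K \<inter> F = B"
    using K BF(2) by (intro BF(3)) (auto intro: indep_mono[OF K(1)])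
  then have "K \<subseteq> J \<union> B" using K(3) B'F by blast
  moreover have "card K = card (J \<union> B)" using K(4) cJ cBB' by simp
  ultimately have "K = J \<union> B" using fin by (intro card_subset_eq) auto
  then show "J \<subseteq> ground M - F \<and> J \<union> B \<in> indep M" using J K(1) by simp
qed (use B in \<open>auto simp: contraction_def\<close>)

text \<open>Enlarging \<open>I\<close> to a basis of \<open>M\<close> adds no element of
  \<open>F\<close> outside \<open>B\<close>, since \<open>B\<close> is already maximal among the
  independent subsets of \<open>F\<close>.\<close>

lemma basis_Int_extend:
  assumes B: "B \<in> bases (restriction M F)" and "I \<in> indep M" "B \<subseteq> I"
  obtains C where "C \<in> bases M" "I \<subseteq> C" "C \<inter> F = B"
proof -
  obtain C where C: "C \<in> bases M" "I \<subseteq> C" using indep_subset_basis assms by metis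
  then have "C \<in> indep M" by (simp add: bases_def)
  then have "C \<inter> F \<in> indep M" by (rule indep_mono) auto
  then have "C \<inter> F = B"
    using B C assms unfolding basis_restriction_iff by (metis Int_greatest inf_le2 subset_trans)
  then show ?thesis using that C by blast
qed

section \<open>The initial matroid as a direct sum of \<open>(M|F)_u\<close> and
  \<open>M/F\<close>\<close>

text \<open>The values of \<open>u\<close> are constrained on \<open>F\<close> only, so that
  \<open>u\<close> may be an extensional function on \<open>F\<close>; the conditional in
  \<open>w_eq\<close> replaces them by 0 elsewhere.\<close>

context
  fixes F :: "'a set" and w u :: "'a \<Rightarrow> 'b::linordered_idom"
  assumes F: "F \<subseteq> ground M"
    and u_pos: "\<And>e. e \<in> F \<Longrightarrow> u e > 0"
    and w_eq: "\<And>e. e \<in> ground M \<Longrightarrow> w e = 1 + (if e \<in> F then u e else 0)"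
begin

text \<open>The constant part of \<open>w\<close> contributes the cardinality of \<open>B\<close>,
  which is the same for all bases.\<close>

lemma sum_weight_basis: "sum w B = of_nat (rk M) + sum u (B \<inter> F)" if B: "B \<in> bases M"
proof -
  have "B \<in> indep M" using B by (simp add: bases_def)
  then have fin: "finite B" and sub: "B \<subseteq> ground M"
    using finite_indep_set indep_subset_ground by auto
  have "sum w B = (\<Sum>e\<in>B. 1 + (if e \<in> F then u e else 0))"
    using sub w_eq by (intro sum.cong) auto
  also have "\<dots> = of_nat (card B) + sum u (B \<inter> F)"
    by (simp add: sum.distrib sum.inter_restrict[OF fin])
  finally show ?thesis using basis_card[OF B] by simp
qed

text \<open>Extend \<open>B \<inter> F\<close> to a basis \<open>C\<close> of \<open>M|F\<close>.
  The weight gained is the sum of \<open>u\<close> over \<open>C - B \<inter> F\<close>; as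
  \<open>u\<close> is positive on \<open>F\<close>, it is nonnegative and vanishes only if
  \<open>C = B \<inter> F\<close>.\<close>

lemma weight_Int_le:
  assumes B: "B \<in> bases M"
  shows "sum u (B \<inter> F) \<le> wt (restriction M F) u"
    and "sum u (B \<inter> F) = wt (restriction M F) u \<Longrightarrow> B \<inter> F \<in> bases (restriction M F)"
proof -
  interpret R: set_system "restriction M F" by (rule set_system_restriction)
  have "B \<in> indep M" using B by (simp add: bases_def)
  then have "B \<inter> F \<in> indep (restriction M F)"
    using indep_mono by (auto simp: restriction_def)
  then obtain C where C: "C \<in> bases (restriction M F)" "B \<inter> F \<subseteq> C"
    by (rule R.indep_subset_basis)
  then have "C \<in> indep M" "C \<subseteq> F" by (auto simp: basis_restriction_iff)
  then have fin: "finite C" by (auto dest: finite_indep_set)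
  have C_le: "sum u C \<le> wt (restriction M F) u" using C(1) by (rule R.sum_le_wt)
  have split: "sum u C = sum u (C - B \<inter> F) + sum u (B \<inter> F)"
    using fin C(2) by (rule sum.subset_diff[rotated])
  have nonneg: "0 \<le> sum u (C - B \<inter> F)"
    using \<open>C \<subseteq> F\<close> u_pos by (intro sum_nonneg) (auto intro: less_imp_le)
  show "sum u (B \<inter> F) \<le> wt (restriction M F) u" using C_le split nonneg by simp
  assume "sum u (B \<inter> F) = wt (restriction M F) u"
  then have "sum u (C - B \<inter> F) \<le> 0" using C_le split by simp
  have "C - B \<inter> F = {}"
  proof (rule ccontr)
    assume "C - B \<inter> F \<noteq> {}"
    then have "0 < sum u (C - B \<inter> F)"
      using fin \<open>C \<subseteq> F\<close> u_pos by (intro sum_pos) auto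
    then show False using \<open>sum u (C - B \<inter> F) \<le> 0\<close> by simp
  qed
  then have "C = B \<inter> F" using C(2) by blast
  then show "B \<inter> F \<in> bases (restriction M F)" using C(1) by simp
qed

text \<open>The upper bound comes from \<open>weight_Int_le\<close>; it is attained because a
  \<open>u\<close>-maximal basis of \<open>M|F\<close> extends to a basis of \<open>M\<close> with
  exactly this trace on \<open>F\<close>.\<close>

lemma wt_restriction: "wt M w = of_nat (rk M) + wt (restriction M F) u"
proof (rule antisym)
  obtain B where B: "B \<in> bases M" "sum w B = wt M w" by (rule wt_attained)
  then show "wt M w \<le> of_nat (rk M) + wt (restriction M F) u"
    using sum_weight_basis[OF B(1)] weight_Int_le(1)[OF B(1)] by simp
next
  obtain B where B: "B \<in> bases (restriction M F)" "sum u B = wt (restriction M F) u"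
    by (rule set_system.wt_attained[OF set_system_restriction])
  then have "B \<in> indep M" by (simp add: basis_restriction_iff)
  then obtain C where C: "C \<in> bases M" "C \<inter> F = B"
    using basis_Int_extend[OF B(1)] by blast
  then have "sum w C = of_nat (rk M) + wt (restriction M F) u"
    using sum_weight_basis B(2) by simp
  then show "of_nat (rk M) + wt (restriction M F) u \<le> wt M w"
    using sum_le_wt[OF C(1), of w] by simp
qed

text \<open>The constant \<open>rk M\<close> cancels, and the equality case of
  \<open>weight_Int_le\<close> supplies the basis property, as required by
  \<open>initial_matroid (restriction M F) u\<close>.\<close>

lemma maximal_basis_iff:
  assumes "B \<in> bases M"
  shows "sum w B = wt M w \<longleftrightarrow>
    B \<inter> F \<in> bases (restriction M F) \<and> sum u (B \<inter> F) = wt (restriction M F) u"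
proof -
  have "sum w B = wt M w \<longleftrightarrow> sum u (B \<inter> F) = wt (restriction M F) u"
    by (simp only: sum_weight_basis[OF assms] wt_restriction add_left_cancel)
  then show ?thesis using weight_Int_le(2)[OF assms] by blast
qed

text \<open>A \<open>w\<close>-maximal basis is cut into its parts inside and outside
  \<open>F\<close>; conversely, \<open>J\<close> is glued to a \<open>u\<close>-maximal basis of
  \<open>M|F\<close> containing \<open>I\<close>.\<close>

lemma indep_initial_matroid:
  "indep (initial_matroid M w) =
    {I \<union> J | I J. I \<in> indep (initial_matroid (restriction M F) u) \<and> J \<in> indep (contraction M F)}"
    (is "_ = ?R")
proof (intro subset_antisym subsetI)
  fix K assume "K \<in> indep (initial_matroid M w)"
  then obtain B where B: "B \<in> bases M" "sum w B = wt M w" "K \<subseteq> B"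
    by (auto simp: initial_matroid_def)
  then have BF: "B \<inter> F \<in> bases (restriction M F)" "sum u (B \<inter> F) = wt (restriction M F) u"
    using maximal_basis_iff by auto
  have Bi: "B \<in> indep M" using B(1) by (simp add: bases_def)
  have "K \<inter> F \<in> indep (initial_matroid (restriction M F) u)"
    using BF B(3) by (auto simp: initial_matroid_def)
  moreover have "K - F \<in> indep (contraction M F)"
    unfolding indep_contraction_iff[OF BF(1)]
    using B(3) indep_subset_ground[OF Bi] by (auto intro: indep_mono[OF Bi])
  moreover have "K = (K \<inter> F) \<union> (K - F)" by blast
  ultimately show "K \<in> ?R" by (intro CollectI exI conjI)
next
  fix K assume "K \<in> ?R"
  then obtain I J where K: "K = I \<union> J" and I: "I \<in> indep (initial_matroid (restriction M F) u)"
    and J: "J \<in> indep (contraction M F)" by blast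
  from I obtain B where B: "B \<in> bases (restriction M F)" "sum u B = wt (restriction M F) u" "I \<subseteq> B"
    by (auto simp: initial_matroid_def)
  \<comment> \<open>The basis witnessing that \<open>J\<close> is independent in \<open>M/F\<close>
    may differ from \<open>B\<close>; \<open>indep_contraction_iff\<close> allows the
    exchange.\<close>
  have "J \<union> B \<in> indep M" using J indep_contraction_iff[OF B(1)] by blast
  then obtain C where C: "C \<in> bases M" "J \<union> B \<subseteq> C" "C \<inter> F = B"
    using basis_Int_extend[OF B(1)] by blast
  then have "sum w C = wt M w" using maximal_basis_iff B by simp
  then show "K \<in> indep (initial_matroid M w)"
    using C B(3) K by (auto simp: initial_matroid_def)
qed

lemma chi_initial_matroid:
  "chi (initial_matroid M w) = chi (initial_matroid (restriction M F) u) * chi (contraction M F)"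
proof -
  have "char_poly (initial_matroid M w) =
      char_poly (initial_matroid (restriction M F) u) * char_poly (contraction M F)"
  proof (rule char_poly_direct_sum)
    show "set_system (initial_matroid (restriction M F) u)"
      by (rule set_system.set_system_initial_matroid[OF set_system_restriction])
    show "set_system (contraction M F)" by (rule set_system_contraction)
    show "set_system (initial_matroid M w)" by (rule set_system_initial_matroid)
    show "indep (initial_matroid M w) = {I \<union> J | I J.
        I \<in> indep (initial_matroid (restriction M F) u) \<and> J \<in> indep (contraction M F)}"
      by (rule indep_initial_matroid)
  qed (use F in \<open>auto simp: initial_matroid_def restriction_def contraction_def\<close>)
  then show ?thesis by (simp add: chi_def)
qed

end

end


section \<open>Positive integer weights of given total\<close>

definition pos_weights :: "'a set \<Rightarrow> nat \<Rightarrow> ('a \<Rightarrow> int) set" where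
  "pos_weights F n = {w. w \<in> F \<rightarrow>\<^sub>E {0<..} \<and> sum w F = int n}"

text \<open>All entries are positive, so each is at most the total \<open>n\<close>, and the weights
  lie in a finite box.\<close>

lemma finite_pos_weights:
  assumes "finite F"
  shows "finite (pos_weights F n)"
proof (rule finite_subset)
  show "pos_weights F n \<subseteq> F \<rightarrow>\<^sub>E {0<..int n}"
  proof
    fix w assume w: "w \<in> pos_weights F n"
    then have pos: "w e > 0" if "e \<in> F" for e
      using that by (auto simp: pos_weights_def PiE_def Pi_def)
    have "w e \<le> int n" if "e \<in> F" for e
      using w member_le_sum[of e F w] that pos assms
      by (auto simp: pos_weights_def intro: less_imp_le)
    then show "w \<in> F \<rightarrow>\<^sub>E {0<..int n}"
      using w pos by (auto simp: pos_weights_def PiE_def)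
  qed
qed (use assms in \<open>auto intro: finite_PiE\<close>)

lemma pos_weights_eq_empty: "n < card F \<Longrightarrow> pos_weights F n = {}"
proof (rule ccontr)
  assume n: "n < card F" and "pos_weights F n \<noteq> {}"
  then obtain w where w: "w \<in> F \<rightarrow>\<^sub>E {0<..}" "sum w F = int n"
    by (auto simp: pos_weights_def)
  have "(\<Sum>e\<in>F. 1) \<le> sum w F"
    using w(1) by (intro sum_mono) (auto simp: PiE_def Pi_def int_one_le_iff_zero_less)
  then show False using n w(2) by simp
qed

text \<open>A weight \<open>w\<close> corresponds to the pair of the support \<open>F\<close> of
  \<open>w - 1\<close> and the restriction of \<open>w - 1\<close> to \<open>F\<close>. Subtracting
  1 everywhere lowers the total by \<open>card E\<close>, the source of the factor T^(#E).\<close>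

lemma sum_pos_weights_shift:
  fixes g :: "('a \<Rightarrow> int) \<Rightarrow> 'b::comm_monoid_add"
  assumes E: "finite E"
  shows "sum g (pos_weights E (n + card E)) =
    (\<Sum>F\<in>Pow E. \<Sum>u\<in>pos_weights F n. g (\<lambda>e\<in>E. 1 + (if e \<in> F then u e else 0)))"
proof -
  define i :: "'a set \<times> ('a \<Rightarrow> int) \<Rightarrow> 'a \<Rightarrow> int"
    where "i = (\<lambda>(F, u). \<lambda>e\<in>E. 1 + (if e \<in> F then u e else 0))"
  define supp where "supp w = {e \<in> E. w e > 1}" for w :: "'a \<Rightarrow> int"
  define j where "j w = (supp w, \<lambda>e\<in>supp w. w e - 1)" for w :: "'a \<Rightarrow> int"
  have sum_i: "sum (i (F, u)) E = sum u F + int (card E)" if "F \<subseteq> E" for F u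
  proof -
    have "sum (i (F, u)) E = (\<Sum>e\<in>E. 1 + (if e \<in> F then u e else 0))"
      unfolding i_def by (intro sum.cong) auto
    also have "\<dots> = int (card E) + sum u (E \<inter> F)"
      by (simp add: sum.distrib sum.inter_restrict[OF E])
    finally show ?thesis using that by (simp add: Int_absorb1)
  qed
  \<comment> \<open>An entry outside \<open>supp w\<close> is a positive integer not above 1, hence
    equal to 1; off \<open>E\<close> both sides are \<open>undefined\<close>.\<close>
  have ij: "i (j w) = w" if "w \<in> pos_weights E m" for w m
  proof
    fix e show "i (j w) e = w e"
    proof (cases "e \<in> E")
      case True
      then have "w e > 0" using that by (auto simp: pos_weights_def PiE_def Pi_def)
      then show ?thesis using True by (auto simp: i_def j_def supp_def)
    next
      case False
      then show ?thesis using that by (auto simp: i_def j_def pos_weights_def PiE_def extensional_def)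
    qed
  qed
  have "sum g (pos_weights E (n + card E)) =
      (\<Sum>(F, u)\<in>Sigma (Pow E) (\<lambda>F. pos_weights F n). g (i (F, u)))"
  proof (rule sum.reindex_bij_witness[of _ i j])
    fix w assume w: "w \<in> pos_weights E (n + card E)"
    show "i (j w) = w" using w by (rule ij)
    have sub: "supp w \<subseteq> E" by (auto simp: supp_def)
    have "sum w E = sum (\<lambda>e\<in>supp w. w e - 1) (supp w) + int (card E)"
      using sum_i[OF sub] ij[OF w] by (metis j_def)
    then have "sum (\<lambda>e\<in>supp w. w e - 1) (supp w) = int n"
      using w by (simp add: pos_weights_def)
    then show "j w \<in> Sigma (Pow E) (\<lambda>F. pos_weights F n)"
      using sub by (auto simp: j_def pos_weights_def supp_def)
    show "(case j w of (F, u) \<Rightarrow> g (i (F, u))) = g w"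
      using ij[OF w] by (simp add: split_beta)
  next
    fix b assume "b \<in> Sigma (Pow E) (\<lambda>F. pos_weights F n)"
    then obtain F u where b: "b = (F, u)" "F \<subseteq> E" "u \<in> pos_weights F n" by blast
    then have u: "u \<in> extensional F" "\<And>e. e \<in> F \<Longrightarrow> u e > 0" "sum u F = int n"
      by (auto simp: pos_weights_def PiE_def Pi_def)
    have supp: "supp (i (F, u)) = F"
      using b(2) u(2) by (auto simp: supp_def i_def)
    have "(\<lambda>e\<in>F. i (F, u) e - 1) = u"
      using b(2) u(1) by (intro ext) (auto simp: i_def extensional_def)
    then show "j (i b) = b" using supp b(1) by (simp add: j_def)
    show "i b \<in> pos_weights E (n + card E)"
      using sum_i[OF b(2), of u] u(2,3) b(1)
      by (auto simp: pos_weights_def i_def add_pos_pos split: if_splits)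
  qed
  also have "\<dots> = (\<Sum>F\<in>Pow E. \<Sum>u\<in>pos_weights F n. g (i (F, u)))"
    using E by (intro sum.Sigma[symmetric]) (auto intro: finite_pos_weights finite_subset)
  finally show ?thesis by (simp add: i_def)
qed

section \<open>The variable q and special values of chi and zeta\<close>

lemma q_var_neq_0: "q_var \<noteq> 0"
  by (simp add: q_var_def)

lemma q_var_neq_1: "q_var \<noteq> 1"
proof
  assume "q_var = 1"
  then have "to_fract [:0, 1:] = to_fract (1 :: int poly)" by (simp add: q_var_def)
  then have "[:0, 1:] = (1 :: int poly)" by (simp only: to_fract_eq_iff)
  then show False by (simp add: one_pCons)
qed

lemma reduced_chi_times: "(q_var - 1) * reduced_chi N = chi N"
  using q_var_neq_1 by (simp add: reduced_chi_def)

lemma chi_ground_empty: "ground N = {} \<Longrightarrow> chi N = 1"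
  by (simp add: chi_def char_poly_def rk_def flip: one_pCons)

lemma local_motivic_zeta_nth:
  "fps_nth (local_motivic_zeta N) n =
    (\<Sum>w\<in>pos_weights (ground N) n.
      chi (initial_matroid N w) * q_var powi (- int (rk N) - wt N w))"
  by (simp add: local_motivic_zeta_def pos_weights_def)

context matroid
begin

text \<open>The bases of \<open>M_w\<close> are among those of \<open>M\<close>, so a loop of
  \<open>M\<close> is a loop of every \<open>M_w\<close> and kills every summand.\<close>

lemma local_motivic_zeta_loop:
  assumes "e \<in> ground M" "{e} \<notin> indep M"
  shows "chi M = 0" and "local_motivic_zeta M = 0"
proof -
  have loop: "e \<notin> I" if "I \<in> indep M" for I
    using that assms(2) indep_mono[of I "{e}"] by blast
  show "chi M = 0" using char_poly_loop[OF assms(1) loop] by (simp add: chi_def)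
  have "chi (initial_matroid M w) = 0" for w :: "'a \<Rightarrow> int"
  proof -
    have "char_poly (initial_matroid M w) = 0"
      by (rule set_system.char_poly_loop[OF set_system_initial_matroid, of e])
        (use assms(1) loop in \<open>auto simp: initial_matroid_def bases_def\<close>)
    then show ?thesis by (simp add: chi_def)
  qed
  then show "local_motivic_zeta M = 0"
    by (intro fps_ext) (simp add: local_motivic_zeta_nth)
qed

lemma restriction_empty: "restriction M {} = \<lparr>ground = {}, indep = {{}}\<rparr>"
  using indep_empty by (auto simp: restriction_def)

lemma contraction_empty: "contraction M {} = M"
proof -
  have "bases (restriction M {}) = {{}}"
    by (auto simp: restriction_empty bases_def)
  then have "{I. I \<subseteq> ground M \<and> (\<exists>B\<in>bases (restriction M {}). I \<union> B \<in> indep M)} = indep M"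
    using indep_subset_ground by auto
  then show ?thesis by (simp add: contraction_def)
qed

lemma local_motivic_zeta_restriction_empty: "local_motivic_zeta (restriction M {}) = 1"
proof (rule fps_ext)
  fix n
  \<comment> \<open>The constant \<open>undefined\<close> is the only extensional function on the
    empty set; its total is 0, so it contributes to the constant coefficient alone.\<close>
  have w: "pos_weights {} n = (if n = 0 then {\<lambda>_. undefined} else {})"
    by (auto simp: pos_weights_def)
  have "bases (restriction M {}) = {{}}"
    by (auto simp: restriction_empty bases_def)
  then have wt: "wt (restriction M {}) (w :: 'a \<Rightarrow> int) = 0" for w
    by (simp add: wt_def)
  have "{I. I = {} \<and> I \<subseteq> {}} = {{} :: 'a set}" by auto
  then have rk: "rk (restriction M {}) = 0"
    by (simp add: restriction_empty rk_def rank_of_def)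
  show "fps_nth (local_motivic_zeta (restriction M {})) n = fps_nth 1 n"
    by (simp add: local_motivic_zeta_nth restriction_empty[THEN arg_cong, of ground] w wt rk
        chi_ground_empty initial_matroid_def)
qed

text \<open>An element \<open>e\<close> of the closure outside \<open>F\<close> is a loop of
  \<open>M/F\<close>: otherwise a basis of \<open>M|F\<close> together with \<open>e\<close> would
  exceed the rank of \<open>insert e F\<close>.\<close>

lemma chi_contraction_nonflat:
  assumes F: "F \<subseteq> ground M" and nonflat: "F \<notin> flats M"
  shows "chi (contraction M F) = 0"
proof -
  have "F \<subseteq> cl M F" using F by (auto simp: cl_def insert_absorb)
  moreover have "cl M F \<noteq> F" using F nonflat by (auto simp: flats_def)
  ultimately obtain e where e: "e \<in> ground M" "e \<notin> F" "rank_of M (insert e F) = rank_of M F"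
    by (auto simp: cl_def)
  have "char_poly (contraction M F) = 0"
  proof (rule set_system.char_poly_loop[OF set_system_contraction])
    show "e \<in> ground (contraction M F)" using e by (simp add: contraction_def)
    fix J assume "J \<in> indep (contraction M F)"
    then obtain B where B: "B \<in> bases (restriction M F)" "J \<union> B \<in> indep M"
      by (auto simp: contraction_def)
    show "e \<notin> J"
    proof
      assume "e \<in> J"
      then have eB: "insert e B \<in> indep M" by (intro indep_mono[OF B(2)]) auto
      have BF: "B \<subseteq> F" using B(1) by (simp add: basis_restriction_iff)
      then have "card (insert e B) = Suc (card B)"
        using e(2) finite_indep_set[OF eB] by (auto intro!: card_insert_disjoint)
      moreover have "card (insert e B) \<le> rank_of M (insert e F)"
        using eB BF by (intro card_le_rank_of) auto
      moreover have "card B = rank_of M F"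
        using matroid.basis_card[OF matroid_restriction B(1)] rk_restriction by simp
      ultimately show False using e(3) by simp
    qed
  qed
  then show ?thesis by (simp add: chi_def)
qed

section \<open>The recurrence over all subsets of the ground set\<close>

text \<open>Coefficients are compared: each weight is split by \<open>sum_pos_weights_shift\<close>,
  and its summand factors by \<open>chi_initial_matroid\<close> and
  \<open>wt_restriction\<close>.\<close>

lemma local_motivic_zeta_all_subsets:
  "fps_const (q_var ^ rk M) * local_motivic_zeta M =
    fps_const (q_var powi (- int (rk M))) * fps_X ^ card (ground M) *
    (\<Sum>F\<in>Pow (ground M).
      fps_const (chi (contraction M F) * q_var ^ rk (restriction M F))
      * local_motivic_zeta (restriction M F))"
proof (rule fps_ext)
  fix n
  let ?E = "ground M" and ?q = q_var
  let ?r = "int (rk M)"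
  let ?S = "\<Sum>F\<in>Pow ?E. fps_const (chi (contraction M F) * ?q ^ rk (restriction M F))
      * local_motivic_zeta (restriction M F)"
  \<comment> \<open>The factor T^(#E) shifts coefficients. Below \<open>card ?E\<close> both sides
    vanish, since positive weights have total at least \<open>card ?E\<close>.\<close>
  have R: "fps_nth (fps_const (?q powi (- ?r)) * fps_X ^ card ?E * ?S) n =
      (if n < card ?E then 0 else ?q powi (- ?r) * fps_nth ?S (n - card ?E))"
    by (simp add: mult.assoc fps_X_power_mult_nth)
  show "fps_nth (fps_const (?q ^ rk M) * local_motivic_zeta M) n =
      fps_nth (fps_const (?q powi (- ?r)) * fps_X ^ card ?E * ?S) n"
  proof (cases "n < card ?E")
    case True
    then show ?thesis unfolding R by (simp add: local_motivic_zeta_nth pos_weights_eq_empty)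
  next
    case False
    define m where "m = n - card ?E"
    have n: "n = m + card ?E" using False by (simp add: m_def)
    define g where "g w = chi (initial_matroid M w) * ?q powi (- ?r - wt M w)" for w
    define h where "h F u = chi (initial_matroid (restriction M F) u)
      * ?q powi (- int (rk (restriction M F)) - wt (restriction M F) u)" for F u
    have shift: "?q ^ rk M * g (\<lambda>e\<in>?E. 1 + (if e \<in> F then u e else 0)) =
        ?q powi (- ?r) * (chi (contraction M F) * ?q ^ rk (restriction M F) * h F u)"
      if F: "F \<subseteq> ?E" and u: "u \<in> pos_weights F m" for F u
    proof -
      let ?w = "\<lambda>e\<in>?E. 1 + (if e \<in> F then u e else 0)"
      let ?s = "int (rk (restriction M F))" and ?t = "wt (restriction M F) u"
      have pos: "\<And>e. e \<in> F \<Longrightarrow> u e > 0"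
        using u by (auto simp: pos_weights_def PiE_def Pi_def)
      have wt: "wt M ?w = ?r + ?t"
        using wt_restriction[OF F pos, where w = ?w] by simp
      have chi: "chi (initial_matroid M ?w) =
          chi (initial_matroid (restriction M F) u) * chi (contraction M F)"
        by (rule chi_initial_matroid[OF F pos]) auto
      \<comment> \<open>The exponent is regrouped so that \<open>- ?s - ?t\<close>, the exponent in
        the zeta function of \<open>M|F\<close>, appears.\<close>
      have "?q powi ?r * ?q powi (- ?r - (?r + ?t)) = ?q powi (- ?r - ?t)"
        by (subst power_int_add[symmetric]) (auto simp: q_var_neq_0)
      also have "\<dots> = ?q powi (- ?r) * (?q powi ?s * ?q powi (- ?s - ?t))"
        by (subst power_int_add[symmetric], simp add: q_var_neq_0)+ simp
      finally show ?thesis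
        by (simp add: g_def h_def wt chi mult_ac)
    qed
    have "fps_nth (fps_const (?q ^ rk M) * local_motivic_zeta M) n =
        (\<Sum>F\<in>Pow ?E. \<Sum>u\<in>pos_weights F m.
          ?q ^ rk M * g (\<lambda>e\<in>?E. 1 + (if e \<in> F then u e else 0)))"
      by (simp add: local_motivic_zeta_nth n sum_pos_weights_shift[OF finite_ground]
          sum_distrib_left flip: g_def)
    also have "\<dots> = (\<Sum>F\<in>Pow ?E. \<Sum>u\<in>pos_weights F m.
        ?q powi (- ?r) * (chi (contraction M F) * ?q ^ rk (restriction M F) * h F u))"
      by (intro sum.cong refl shift) auto
    also have "\<dots> = ?q powi (- ?r) * fps_nth ?S m"
    proof -
      have "fps_nth (local_motivic_zeta (restriction M F)) m = sum (h F) (pos_weights F m)"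
        if "F \<subseteq> ?E" for F
      proof -
        have "ground (restriction M F) = F" using that by (auto simp: restriction_def)
        then show ?thesis by (simp add: local_motivic_zeta_nth h_def)
      qed
      then have "fps_nth ?S m = (\<Sum>F\<in>Pow ?E. chi (contraction M F)
          * ?q ^ rk (restriction M F) * sum (h F) (pos_weights F m))"
        by (simp add: fps_sum_nth)
      then show ?thesis by (simp add: sum_distrib_left)
    qed
    finally show ?thesis unfolding R using False by (simp add: m_def)
  qed
qed

section \<open>From all subsets to proper nonempty flats\<close>

text \<open>A loop never raises the rank, so it lies in every closure.\<close>

lemma loop_in_flat:
  assumes F: "F \<in> flats M" and e: "e \<in> ground M" "{e} \<notin> indep M"
  shows "e \<in> F"
proof -
  have "e \<notin> I" if "I \<in> indep M" for I
    using that e(2) indep_mono[of I "{e}"] by blast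
  then have "{I \<in> indep M. I \<subseteq> insert e F} = {I \<in> indep M. I \<subseteq> F}" by blast
  then have "e \<in> cl M F" using e(1) by (simp add: cl_def rank_of_def)
  then show ?thesis using F by (simp add: flats_def)
qed

lemma cl_empty_loopless:
  assumes "\<And>e. e \<in> ground M \<Longrightarrow> {e} \<in> indep M"
  shows "cl M {} = {}"
proof -
  have "rank_of M {e} \<noteq> rank_of M {}" if "e \<in> ground M" for e
  proof -
    have "{I \<in> indep M. I = {}} = {{}}" using indep_empty by auto
    then have "rank_of M {} = 0" by (simp add: rank_of_def)
    moreover have "card {e} \<le> rank_of M {e}" using assms[OF that] by (rule card_le_rank_of) simp
    ultimately show ?thesis by simp
  qed
  then show ?thesis by (auto simp: cl_def)
qed

end

theorem theorem1p6:
  fixes M :: "'a indep_structure"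
  assumes "matroid M" and "ground M \<noteq> {}"
  shows "fps_const (q_var ^ rk M) * local_motivic_zeta M =
    (fps_const ((q_var - 1) * q_var powi (- int (rk M))) * fps_X ^ card (ground M))
      / (1 - fps_const (q_var powi (- int (rk M))) * fps_X ^ card (ground M))
    * (fps_const (reduced_chi M)
       + (\<Sum>F\<in>flats M - {cl M {}, ground M}.
            fps_const (reduced_chi (contraction M F) * q_var ^ rk (restriction M F))
            * local_motivic_zeta (restriction M F)))"
proof -
  interpret matroid M by fact
  let ?E = "ground M"
  show ?thesis
  proof (cases "\<exists>e\<in>?E. {e} \<notin> indep M")
    case True
    then obtain e where e: "e \<in> ?E" "{e} \<notin> indep M" by blast
    \<comment> \<open>Every flat contains the loop \<open>e\<close>, so each \<open>M|F\<close> has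
      a loop and both sides of the claim are 0.\<close>
    have "local_motivic_zeta (restriction M F) = 0" if "F \<in> flats M" for F
      by (rule matroid.local_motivic_zeta_loop(2)[OF matroid_restriction, of e])
        (use e loop_in_flat[OF that e] in \<open>auto simp: restriction_def\<close>)
    then show ?thesis
      using local_motivic_zeta_loop[OF e] by (simp add: reduced_chi_def)
  next
    case False
    then have cl: "cl M {} = {}" using cl_empty_loopless by blast
    define x where "x = fps_const (q_var powi (- int (rk M))) * fps_X ^ card ?E"
    define t where "t F = fps_const (chi (contraction M F) * q_var ^ rk (restriction M F))
      * local_motivic_zeta (restriction M F)" for F
    define t' where "t' F = fps_const (reduced_chi (contraction M F) * q_var ^ rk (restriction M F))
      * local_motivic_zeta (restriction M F)" for F
    define Z where "Z = fps_const (q_var ^ rk M) * local_motivic_zeta M"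
    define A where "A = fps_const (reduced_chi M) + sum t' (flats M - {{}, ?E})"
    \<comment> \<open>A nonempty ground set makes \<open>x\<close> a series without constant term,
      so \<open>1 - x\<close> is invertible.\<close>
    have "card ?E > 0" using assms(2) finite_ground by (simp add: card_gt_0_iff)
    then have unit: "fps_nth (1 - x) 0 \<noteq> 0" by (simp add: x_def)
    have t_red: "t F = fps_const (q_var - 1) * t' F" for F
      by (simp add: t_def t'_def flip: reduced_chi_times)
    have tE: "t ?E = Z"
      \<comment> \<open>The contraction by the whole ground set is empty and has chi equal to
        1.\<close>
      by (simp add: t_def Z_def restriction_ground chi_ground_empty contraction_def)
    have rk0: "rk (restriction M {}) = 0"
    proof -
      have "{I \<in> indep M. I = {}} = {{}}" using indep_empty by auto
      then show ?thesis by (simp add: rk_restriction rank_of_def)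
    qed
    have t0: "t {} = fps_const (q_var - 1) * fps_const (reduced_chi M)"
      by (simp add: t_def contraction_empty rk0 local_motivic_zeta_restriction_empty
          reduced_chi_times)
    have flats: "{} \<in> flats M" "?E \<in> flats M" "flats M \<subseteq> Pow ?E"
      using cl by (auto simp: flats_def cl_def insert_absorb)
    then have fin: "finite (flats M)" using finite_ground by (auto intro: finite_subset)
    \<comment> \<open>Subsets that are not flats contribute 0.\<close>
    have "sum t (Pow ?E) = sum t (flats M)"
      using flats(3) finite_ground
      by (intro sum.mono_neutral_right) (auto simp: t_def chi_contraction_nonflat)
    also have "\<dots> = t ?E + (t {} + sum t (flats M - {{}, ?E}))"
    proof -
      have "sum t (flats M) = t ?E + sum t (flats M - {?E})"
        using fin flats(2) by (rule sum.remove)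
      \<comment> \<open>\<open>{}\<close> and \<open>?E\<close> are distinct flats because the
        ground set is nonempty, so both can be split off.\<close>
      also have "sum t (flats M - {?E}) = t {} + sum t (flats M - {?E} - {{}})"
        using fin flats(1) assms(2) by (intro sum.remove) auto
      also have "flats M - {?E} - {{}} = flats M - {{}, ?E}" by blast
      finally show ?thesis .
    qed
    also have "\<dots> = Z + fps_const (q_var - 1) * A"
    proof -
      have "sum t (flats M - {{}, ?E}) = fps_const (q_var - 1) * sum t' (flats M - {{}, ?E})"
        unfolding sum_distrib_left by (rule sum.cong[OF refl t_red])
      then show ?thesis by (simp only: tE t0 A_def distrib_left)
    qed
    finally have "Z = x * (Z + fps_const (q_var - 1) * A)"
      using local_motivic_zeta_all_subsets by (simp add: Z_def x_def t_def)
    \<comment> \<open>The summand for \<open>?E\<close> reproduces \<open>Z\<close> with factor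
      \<open>x\<close>; moving it to the left yields the denominator \<open>1 - x\<close>.\<close>
    then have eq: "(1 - x) * Z = x * (fps_const (q_var - 1) * A)"
      unfolding distrib_left left_diff_distrib mult_1_left by (simp only: diff_eq_eq add.commute)
    have "Z = inverse (1 - x) * ((1 - x) * Z)"
      by (simp only: mult.assoc[symmetric] inverse_mult_eq_1[OF unit] mult_1_left)
    also have "\<dots> = fps_const (q_var - 1) * x * inverse (1 - x) * A"
      unfolding eq by (simp only: mult_ac)
    also have "fps_const (q_var - 1) * x * inverse (1 - x) = fps_const (q_var - 1) * x / (1 - x)"
      by (rule fps_divide_unit[OF unit, symmetric])
    also have "fps_const (q_var - 1) * x =
        fps_const ((q_var - 1) * q_var powi (- int (rk M))) * fps_X ^ card ?E"
      by (simp add: x_def flip: mult.assoc)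
    finally show ?thesis
      unfolding Z_def A_def t'_def x_def cl .
  qed
qed

end
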